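(* Let $d\geq 2$ be an integer, let $c\in\mathbb{Z}$ be nonzero, and let $f(x)=x^d+c$. Assume that $f^n(\alpha)=\epsilon y^p$ for some $\alpha,y\in\mathbb{Z}$, some $\epsilon\in\{1,-1\}$, some prime $p\mid d$, and some integer $n$, where $n\geq 4$ if $d=2$ and $n\geq 3$ if $d\geq 3$. Then $\alpha$ is a preperiodic point for $f$ and $\epsilon y^p$ is a periodic point for $f$.
   Context: $f^n$ denotes the $n$-th iterate (compositional power) of $f$. A point $\beta$ is periodic for $f$ if $f^n(\beta)=\beta$ for some $n\geq 1$, and preperiodic for $f$ if $f^m(\beta)$ is periodic for some $m\geq 0$. *)

theory Defs
  imports "HOL-Computational_Algebra.Primes"
begin

definition periodic_point :: "('a \<Rightarrow> 'a) \<Rightarrow> 'a \<Rightarrow> bool" where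
  "periodic_point f b \<longleftrightarrow> (\<exists>n\<ge>1. (f ^^ n) b = b)"

definition preperiodic_point :: "('a \<Rightarrow> 'a) \<Rightarrow> 'a \<Rightarrow> bool" where
  "preperiodic_point f b \<longleftrightarrow> (\<exists>m. periodic_point f ((f ^^ m) b))"

end

theory Submission
  imports Defs
begin

text \<open>
  Write \<open>X\<close>, \<open>W\<close>, \<open>V\<close>, \<open>U\<close> for the last points of the orbit before \<open>f\<^sup>n(\<alpha>)\<close>, so that
  \<open>f(U) = V\<close>, \<open>f(V) = W\<close>, \<open>f(W) = X\<close> and \<open>f(X) = \<epsilon> y\<^sup>p\<close>; the point \<open>U\<close> occurs only for \<open>d = 2\<close>.
  The argument shows that \<open>f(X) = W\<close>, i.e. that the orbit has already entered a cycle of length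
  one or two.

  Since \<open>p\<close> divides \<open>d\<close>, the equation \<open>X\<^sup>d + c = \<epsilon> y\<^sup>p\<close> exhibits \<open>c \<noteq> 0\<close> either as a difference
  of two \<open>p\<close>-th powers, one of them \<open>X\<^sup>d\<close>, or (for \<open>p = 2\<close>, \<open>\<epsilon> = -1\<close>) as minus a sum of two squares.
  Distinct powers lie far apart (lemma \<open>power_gap\<close>), so \<open>X\<close> is small compared with \<open>c\<close>.
  Consequently \<open>W\<^sup>d = X - c\<close> is close to \<open>-c\<close>, and then so is \<open>V\<^sup>d = W - c\<close>.
  But \<open>V\<^sup>d\<close> and \<open>W\<^sup>d\<close> are again powers with the small difference \<open>W - X\<close>, and the
  gap principle, applied a second time, leaves few possibilities. The main one is
  \<open>V\<^sup>d = W\<^sup>d\<close>, which means that \<open>W = X\<close> is a fixed point.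

  For \<open>d \<ge> 3\<close> the gaps are so large that \<open>X\<^sup>2 \<le> \<bar>c\<bar>\<close> suffices to force
  \<open>V\<^sup>d = W\<^sup>d\<close> unless \<open>\<bar>W\<bar> \<le> 1\<close> (lemmas \<open>square_le_abs_const\<close> and \<open>two_cycle_degree_ge_3\<close>).
  For \<open>d = 2\<close> the gap between consecutive squares has the same order of magnitude as the
  difference in question, so neighbouring squares remain possible. They are treated by hand
  (lemmas \<open>two_cycle_quadratic_diff\<close> and \<open>two_cycle_quadratic_sum\<close>) and yield cycles of length
  exactly two. When \<open>c\<close> is a difference of two squares the bound on \<open>X\<close> is
  only linear in \<open>c\<close>, and one further point \<open>U\<close> of the orbit has to be used.
\<close>

section \<open>Gaps between powers\<close>

lemma power_convex_step:
  fixes b :: int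
  assumes "b \<ge> 1"
  shows "2 * b ^ n \<le> (b + 1) ^ n + (b - 1) ^ n"
proof (induction n)
  case 0
  then show ?case by simp
next
  case (Suc n)
  have "(b - 1) ^ n \<le> (b + 1) ^ n"
    using assms by (intro power_mono) auto
  moreover have "b * (2 * b ^ n) \<le> b * ((b + 1) ^ n + (b - 1) ^ n)"
    using Suc.IH assms by (intro mult_left_mono) auto
  ultimately show ?case by (simp add: algebra_simps)
qed

text \<open>
  By convexity the nearest \<open>n\<close>-th power to \<open>\<bar>b\<bar>\<^sup>n\<close> is the one just below it. A power
  of the opposite sign is at distance at least \<open>\<bar>b\<bar>\<^sup>n\<close>.
\<close>

lemma power_gap:
  fixes a b :: int
  assumes "a ^ n \<noteq> b ^ n" "b \<noteq> 0"
  shows "\<bar>b\<bar> ^ n - (\<bar>b\<bar> - 1) ^ n \<le> \<bar>a ^ n - b ^ n\<bar>"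
proof -
  have b1: "\<bar>b\<bar> \<ge> 1" using assms by linarith
  have nn: "0 \<le> (\<bar>b\<bar> - 1) ^ n" using b1 by simp
  have ab: "\<bar>a ^ n\<bar> = \<bar>a\<bar> ^ n" "\<bar>b ^ n\<bar> = \<bar>b\<bar> ^ n" by (simp_all add: power_abs)
  consider "\<bar>a\<bar> = \<bar>b\<bar>" | "\<bar>a\<bar> \<le> \<bar>b\<bar> - 1" | "\<bar>b\<bar> + 1 \<le> \<bar>a\<bar>" by linarith
  then show ?thesis
  proof cases
    case 1
    then have "\<bar>a ^ n\<bar> = \<bar>b ^ n\<bar>" using ab by simp
    then have "a ^ n = - (b ^ n)" using assms(1) by linarith
    then have "\<bar>a ^ n - b ^ n\<bar> = 2 * \<bar>b\<bar> ^ n" using ab by linarith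
    then show ?thesis using nn by (smt (verit) zero_le_power b1)
  next
    case 2
    then have "\<bar>a\<bar> ^ n \<le> (\<bar>b\<bar> - 1) ^ n" by (intro power_mono) auto
    then show ?thesis using ab by linarith
  next
    case 3
    then have "(\<bar>b\<bar> + 1) ^ n \<le> \<bar>a\<bar> ^ n" by (intro power_mono) auto
    then show ?thesis using ab power_convex_step[OF b1, of n] by linarith
  qed
qed

lemma power_diff_pred_ge:
  fixes b :: int
  assumes "b \<ge> 1" "n \<ge> 1"
  shows "b ^ (n - 1) \<le> b ^ n - (b - 1) ^ n"
proof -
  obtain m where n: "n = Suc m" using assms(2) by (cases n) auto
  have "(b - 1) ^ m \<le> b ^ m" using assms by (intro power_mono) auto
  then have "(b - 1) * (b - 1) ^ m \<le> (b - 1) * b ^ m"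
    using assms by (intro mult_left_mono) auto
  then show ?thesis by (simp add: n algebra_simps)
qed

text \<open>
  For exponents at least three the gap exceeds \<open>w\<^sup>d\<^sup>-\<^sup>1\<close> by at least \<open>w\<close>; already the
  cubic case \<open>3 w\<^sup>2 - 3 w + 1 \<ge> w\<^sup>2 + w\<close> shows this, and the remaining factors only help.
\<close>

lemma power_diff_pred_ge_add:
  fixes w :: int
  assumes w: "w \<ge> 2" and d: "d \<ge> 3"
  shows "w ^ (d - 1) + w \<le> w ^ d - (w - 1) ^ d"
proof -
  obtain m where m: "d = m + 3" using d by (metis add.commute le_Suc_ex)
  have ww: "2 * w \<le> w * w" using w by (intro mult_right_mono) auto
  have "(w - 1) ^ m \<le> w ^ m" using w by (intro power_mono) auto
  then have 1: "(w - 1) ^ 3 * (w - 1) ^ m \<le> (w - 1) ^ 3 * w ^ m"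
    using w by (intro mult_left_mono) auto
  have 2: "1 * (2 * w * w - 3 * w + 1) \<le> w ^ m * (2 * w * w - 3 * w + 1)"
    using w ww by (intro mult_right_mono one_le_power) linarith+
  show ?thesis using 1 2 ww
    by (simp add: m power_add algebra_simps power2_eq_square power3_eq_cube)
qed

lemma abs_power_le_1_or_ge_4:
  fixes a :: int
  assumes "n \<ge> 2"
  shows "\<bar>a ^ n\<bar> \<le> 1 \<or> 4 \<le> \<bar>a ^ n\<bar>"
proof (cases "\<bar>a\<bar> \<le> 1")
  case True
  then show ?thesis by (simp add: power_abs power_le_one)
next
  case False
  then have "\<bar>a\<bar> ^ 2 \<le> \<bar>a\<bar> ^ n" using assms by (intro power_increasing) auto
  moreover have "2 ^ 2 \<le> \<bar>a\<bar> ^ 2" using False by (intro power_mono) auto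
  ultimately show ?thesis by (simp add: power_abs)
qed

section \<open>Quadratic polynomials\<close>

text \<open>
  Squares of two nonnegative integers that differ by at least two are at
  distance at least twice the sum of these integers.
\<close>

lemma abs_diff_ge_2_imp_squares_far:
  fixes u v :: int
  assumes "u \<ge> 0" "v \<ge> 0" "\<bar>u - v\<bar> \<ge> 2"
  shows "2 * (u + v) \<le> \<bar>u\<^sup>2 - v\<^sup>2\<bar>"
proof -
  have "2 * (u + v) \<le> \<bar>u - v\<bar> * (u + v)"
    using assms by (intro mult_right_mono) auto
  also have "\<dots> = \<bar>(u - v) * (u + v)\<bar>" using assms by (simp add: abs_mult)
  also have "(u - v) * (u + v) = u\<^sup>2 - v\<^sup>2" by (simp add: algebra_simps power2_eq_square)
  finally show ?thesis .
qed

lemma int_le_square: "(x::int) \<le> x\<^sup>2"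
proof -
  have "1 * \<bar>x\<bar> \<le> \<bar>x\<bar> * \<bar>x\<bar>"
    by (cases "x = 0") (simp, intro mult_right_mono, auto)
  then show ?thesis by (simp add: power2_eq_square)
qed

text \<open>
  Here \<open>c = -k\<close> is a difference of two squares. The gap principle bounds \<open>\<bar>X\<bar>\<close> by about \<open>k / 2\<close>,
  so that \<open>W\<^sup>2 \<le> (3 k + 1) / 2\<close>, whereas \<open>V\<^sup>2 = k + W\<close> and \<open>U\<^sup>2 = k + V\<close> have size about \<open>k\<close>.
  As \<open>U\<^sup>2 - V\<^sup>2 = V - W\<close>, the absolute values of \<open>U\<close> and \<open>V\<close> differ by at most one.
  Equality makes \<open>V\<close> a fixed point. Of the four configurations
  with consecutive absolute values (two signs of \<open>V\<close>, two signs of \<open>\<bar>U\<bar> - \<bar>V\<bar>\<close>) only \<open>V = -v\<close>,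
  \<open>W = v - 1\<close> with \<open>v \<ge> 1\<close> survives, and there \<open>V\<close> and \<open>W\<close> are exchanged.
\<close>

lemma two_cycle_quadratic_diff:
  fixes U V W X y k :: int
  assumes k0: "k \<noteq> 0"
    and V: "V = U\<^sup>2 - k" and W: "W = V\<^sup>2 - k" and X: "X = W\<^sup>2 - k"
    and y: "y\<^sup>2 = X\<^sup>2 - k"
  shows "X\<^sup>2 - k = W"
proof -
  have Xk: "2 * \<bar>X\<bar> - 1 \<le> \<bar>k\<bar>"
  proof (cases "X = 0")
    case False
    then show ?thesis using power_gap[of y 2 X] k0 y
      by (simp add: power2_eq_square algebra_simps)
  qed simp
  have k: "k \<ge> 1"
  proof (rule ccontr)
    assume "\<not> k \<ge> 1"
    then have neg: "k \<le> -1" using k0 by linarith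
    have "W \<ge> 1" using W neg zero_le_power2[of V] by linarith
    then show False using neg Xk X int_le_square[of W] by linarith
  qed
  have W2: "2 * W\<^sup>2 \<le> 3 * k + 1" using Xk X k by linarith
  define u v w where "u = \<bar>U\<bar>" and "v = \<bar>V\<bar>" and "w = \<bar>W\<bar>"
  have nn: "u \<ge> 0" "v \<ge> 0" "w \<ge> 0" by (simp_all add: u_def v_def w_def)
  have sq: "u\<^sup>2 = k + V" "v\<^sup>2 = k + W" "w\<^sup>2 = W\<^sup>2" "v\<^sup>2 = V\<^sup>2"
    using V W by (simp_all add: u_def v_def w_def)
  have close: "\<bar>u - v\<bar> \<le> 1"
  proof (rule ccontr)
    assume "\<not> \<bar>u - v\<bar> \<le> 1"
    then have "2 * (u + v) \<le> \<bar>u\<^sup>2 - v\<^sup>2\<bar>"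
      using nn by (intro abs_diff_ge_2_imp_squares_far) auto
    also have "u\<^sup>2 - v\<^sup>2 = V - W" using sq by simp
    also have "\<bar>V - W\<bar> \<le> v + w" unfolding v_def w_def by (rule abs_triangle_ineq4)
    finally have "2 * u + v \<le> w" by simp
    then have le: "2 * u + v \<le> w" "(2 * u + v)\<^sup>2 \<le> w\<^sup>2"
      using nn by (auto intro!: power_mono)
    define q where "q = u * v"
    have "(2 * u + v)\<^sup>2 = 4 * u\<^sup>2 + 4 * (u * v) + v\<^sup>2"
      by (simp add: power2_eq_square algebra_simps)
    then have "4 * u\<^sup>2 + 4 * (u * v) + v\<^sup>2 \<le> W\<^sup>2" using le(2) sq(3) by simp
    then have "2 * (4 * u\<^sup>2 + 4 * (u * v) + v\<^sup>2) \<le> 2 * W\<^sup>2" by (intro mult_left_mono) auto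
    also note W2
    finally have main: "7 * k + 8 * V + 8 * q + 2 * W \<le> 1"
      unfolding sq(1,2) q_def by (simp add: algebra_simps)
    have large: "7 * k \<le> 1 + 2 * w" if "u \<noteq> 0"
    proof -
      have "1 * v \<le> u * v" using nn that by (intro mult_right_mono) auto
      then have "0 \<le> V + q" using v_def q_def by linarith
      then have "7 * k + 2 * W \<le> 1" using main by linarith
      then show ?thesis using w_def by linarith
    qed
    have wk: "k \<le> w"
    proof (cases "u = 0")
      case True
      then show ?thesis using sq le v_def by simp
    next
      case False
      then show ?thesis using large k by linarith
    qed
    show False
    proof (cases "u = 0")
      case True
      then have "v = k" "V = - k" using sq k v_def by simp_all
      then have Wk: "W = k * (k - 1)" using W by (simp add: power2_eq_square algebra_simps)
      then have "W \<ge> 0" using k by simp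
      then have "k \<le> k * (k - 1)" using wk Wk w_def by simp
      then have "k \<ge> 2" using k by (cases "k = 1") auto
      moreover have "k\<^sup>2 \<le> w\<^sup>2" using wk k by (intro power_mono) auto
      moreover have "2 * k \<le> k\<^sup>2"
        using calculation by (simp add: power2_eq_square)
      ultimately show False using W2 sq by linarith
    next
      case False
      then have "3 * k \<le> w" using large k by linarith
      then have "(3 * k)\<^sup>2 \<le> w\<^sup>2" using k by (intro power_mono) auto
      then show False using int_le_square[of k] W2 sq k by (simp add: power_mult_distrib)
    qed
  qed
  have v2: "v \<le> v\<^sup>2" by (rule int_le_square)
  consider "u = v" | "u = v + 1" | "u = v - 1" using close by linarith
  then have "X = V"
  proof cases
    case 1
    then show ?thesis using sq X W by simp
  next
    case 2
    then have "u\<^sup>2 = v\<^sup>2 + 2 * v + 1" by algebra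
    then have Weq: "W = V - 2 * v - 1" using sq by linarith
    show ?thesis
    proof (cases "V \<ge> 0")
      case True
      then have "W = - v - 1" using Weq v_def by simp
      moreover from this have "W\<^sup>2 = v\<^sup>2 + 2 * v + 1" by algebra
      ultimately have "X = v" "X\<^sup>2 - k = - v - 1" using X sq by auto
      then show ?thesis using y nn zero_le_power2[of y] by linarith
    next
      case False
      then have "v \<ge> 1" "W = - 3 * v - 1" using Weq v_def by simp_all
      moreover from this have "W\<^sup>2 = 9 * v\<^sup>2 + 6 * v + 1" by algebra
      ultimately show ?thesis using W2 sq v2 by linarith
    qed
  next
    case 3
    then have "u\<^sup>2 = v\<^sup>2 - 2 * v + 1" by algebra
    then have Weq: "W = V + 2 * v - 1" using sq by linarith
    have v1: "v \<ge> 1" using 3 nn by linarith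
    show ?thesis
    proof (cases "V \<ge> 0")
      case True
      then have "W = 3 * v - 1" using Weq v_def by simp
      moreover from this have "W\<^sup>2 = 9 * v\<^sup>2 - 6 * v + 1" by algebra
      ultimately show ?thesis using W2 sq v2 v1 by linarith
    next
      case False
      then have "V = - v" "W = v - 1" using Weq v_def by simp_all
      moreover from this have "W\<^sup>2 = v\<^sup>2 - 2 * v + 1" by algebra
      ultimately show ?thesis using X sq by linarith
    qed
  qed
  then show ?thesis using W by simp
qed

text \<open>
  Here \<open>k = -c\<close> is a sum of two squares, which gives the stronger bound \<open>X\<^sup>2 \<le> k\<close>; the
  comparison can therefore be carried out one step later in the orbit,
  between \<open>V\<^sup>2 = k + W\<close> and \<open>W\<^sup>2 = k + X\<close>.
\<close>

lemma two_cycle_quadratic_sum: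
  fixes V W X y k :: int
  assumes k0: "k \<noteq> 0"
    and W: "W = V\<^sup>2 - k" and X: "X = W\<^sup>2 - k"
    and y: "- (y\<^sup>2) = X\<^sup>2 - k"
  shows "X\<^sup>2 - k = W"
proof -
  have Xk: "X\<^sup>2 \<le> k" using y zero_le_power2[of y] by linarith
  then have k: "k \<ge> 1" using k0 zero_le_power2[of X] by linarith
  define v w x where "v = \<bar>V\<bar>" and "w = \<bar>W\<bar>" and "x = \<bar>X\<bar>"
  have nn: "v \<ge> 0" "w \<ge> 0" "x \<ge> 0" by (simp_all add: v_def w_def x_def)
  have sq: "w\<^sup>2 = k + X" "v\<^sup>2 = k + W" "x\<^sup>2 = X\<^sup>2" "w\<^sup>2 = W\<^sup>2"
    using X W by (simp_all add: v_def w_def x_def)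
  have xk: "x \<le> k" using int_le_square[of x] sq Xk by linarith
  have close: "\<bar>v - w\<bar> \<le> 1"
  proof (rule ccontr)
    assume "\<not> \<bar>v - w\<bar> \<le> 1"
    then have "2 * (v + w) \<le> \<bar>v\<^sup>2 - w\<^sup>2\<bar>"
      using nn by (intro abs_diff_ge_2_imp_squares_far) auto
    also have "v\<^sup>2 - w\<^sup>2 = W - X" using sq by simp
    also have "\<bar>W - X\<bar> \<le> w + x" unfolding w_def x_def by (rule abs_triangle_ineq4)
    finally have "2 * v + w \<le> x" by simp
    then have le: "2 * v + w \<le> x" "(2 * v + w)\<^sup>2 \<le> x\<^sup>2"
      using nn by (auto intro!: power_mono)
    have "(2 * v + w)\<^sup>2 = 4 * v\<^sup>2 + 4 * (v * w) + w\<^sup>2"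
      by (simp add: power2_eq_square algebra_simps)
    then have main: "4 * v\<^sup>2 + 4 * (v * w) + w\<^sup>2 \<le> k" using le Xk sq by linarith
    show False
    proof (cases "v = 0")
      case True
      then have Wk: "W = - k" using sq by simp
      then have "x = k" using le True xk w_def k by simp
      then have "k\<^sup>2 \<le> k" using Xk sq by simp
      then have "k = 1" using k by (simp add: power2_eq_square)
      then show False using Wk X \<open>x = k\<close> x_def by simp
    next
      case False
      then have "1 * w \<le> v * w" using nn by (intro mult_right_mono) auto
      then show False using main sq w_def x_def xk k by linarith
    qed
  qed
  have w2: "w \<le> w\<^sup>2" by (rule int_le_square)
  consider "v = w" | "v = w + 1" | "v = w - 1" using close by linarith
  then show ?thesis
  proof cases
    case 1
    then have "W = X" using sq by simp
    then show ?thesis using X by simp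
  next
    case 2
    then have "v\<^sup>2 = w\<^sup>2 + 2 * w + 1" by algebra
    then have Xeq: "X = W - 2 * w - 1" using sq by linarith
    show ?thesis
    proof (cases "W \<ge> 0")
      case True
      then have Xw: "X = - w - 1" using Xeq w_def by simp
      then have X2: "X\<^sup>2 = w\<^sup>2 + 2 * w + 1" by algebra
      then have "w = 0" using Xw sq Xk nn by linarith
      then show ?thesis using Xw sq w_def by simp
    next
      case False
      then have "w \<ge> 1" "X = - 3 * w - 1" using Xeq w_def by simp_all
      moreover from this have "X\<^sup>2 = 9 * w\<^sup>2 + 6 * w + 1" by algebra
      ultimately show ?thesis using Xk sq w2 by linarith
    qed
  next
    case 3
    then have "v\<^sup>2 = w\<^sup>2 - 2 * w + 1" by algebra
    then have Xeq: "X = W + 2 * w - 1" using sq by linarith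
    have w1: "w \<ge> 1" using 3 nn by linarith
    show ?thesis
    proof (cases "W \<ge> 0")
      case True
      then have "X = 3 * w - 1" using Xeq w_def by simp
      moreover from this have "X\<^sup>2 = 9 * w\<^sup>2 - 6 * w + 1" by algebra
      ultimately show ?thesis using Xk sq w2 w1 by linarith
    next
      case False
      then have "W = - w" "X = w - 1" using Xeq w_def by simp_all
      moreover from this have "X\<^sup>2 = w\<^sup>2 - 2 * w + 1" by algebra
      ultimately show ?thesis using sq by linarith
    qed
  qed
qed

section \<open>Polynomials of degree at least three\<close>

text \<open>
  With \<open>d = p e\<close>, \<open>c\<close> is a difference of two \<open>p\<close>-th powers, one of them \<open>(X\<^sup>e)\<^sup>p\<close>; its distance
  to any other \<open>p\<close>-th power is at least \<open>\<bar>X\<bar>\<close> to the power \<open>e (p - 1)\<close>, and this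
  exponent is at least two unless \<open>d = 2\<close>. The sign \<open>\<epsilon> = -1\<close> can be
  absorbed into \<open>y\<close> unless \<open>p = 2\<close>, when \<open>-c = X\<^sup>d + y\<^sup>2\<close>.
\<close>

lemma square_le_abs_const:
  fixes X c y \<epsilon> :: int
  assumes d: "d \<ge> 3" and p: "prime p" "p dvd d" and c: "c \<noteq> 0"
    and \<epsilon>: "\<epsilon> \<in> {1, -1}" and eq: "X ^ d + c = \<epsilon> * y ^ p"
  shows "X\<^sup>2 \<le> \<bar>c\<bar>"
proof (cases "X = 0")
  case False
  then have X1: "\<bar>X\<bar> \<ge> 1" by linarith
  have p2: "p \<ge> 2" using p prime_ge_2_nat by blast
  show ?thesis
  proof (cases "\<epsilon> = -1 \<and> even p")
    case True
    then have "even d" using p by auto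
    then have "X ^ d = \<bar>X\<bar> ^ d" by (simp add: power_even_abs)
    moreover have "\<bar>X\<bar> ^ 2 \<le> \<bar>X\<bar> ^ d" using X1 d by (intro power_increasing) auto
    moreover have "y ^ p \<ge> 0" using True by (simp add: zero_le_even_power)
    ultimately show ?thesis using True eq by simp
  next
    case odd: False
    obtain Y where Y: "\<epsilon> * y ^ p = Y ^ p"
    proof (cases "\<epsilon> = 1")
      case False
      then have "\<epsilon> * y ^ p = (- y) ^ p" using odd \<epsilon> by auto
      then show ?thesis by (rule that)
    qed (use that[of y] in simp)
    obtain e where e: "d = p * e" using p by auto
    define Z where "Z = X ^ e"
    have Zp: "Z ^ p = X ^ d" by (simp add: Z_def e power_mult[symmetric] mult.commute)
    have Z0: "Z \<noteq> 0" using False by (simp add: Z_def)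
    have e2: "2 \<le> e * (p - 1)"
    proof (cases "e = 1")
      case True
      then show ?thesis using d e by simp
    next
      case False
      then have "2 \<le> e" using e d by (cases e) auto
      then have "2 * 1 \<le> e * (p - 1)" using p2 by (intro mult_le_mono) auto
      then show ?thesis by simp
    qed
    have "X\<^sup>2 = \<bar>X\<bar> ^ 2" by simp
    also have "\<dots> \<le> \<bar>X\<bar> ^ (e * (p - 1))" using X1 e2 by (intro power_increasing)
    also have "\<dots> = \<bar>Z\<bar> ^ (p - 1)" by (simp add: Z_def power_abs power_mult)
    also have "\<dots> \<le> \<bar>Z\<bar> ^ p - (\<bar>Z\<bar> - 1) ^ p"
      using Z0 p2 by (intro power_diff_pred_ge) auto
    also have "\<dots> \<le> \<bar>Y ^ p - Z ^ p\<bar>"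
      using Z0 eq Y Zp c by (intro power_gap) auto
    also have "Y ^ p - Z ^ p = c" using eq Y Zp by simp
    finally show ?thesis .
  qed
qed simp

text \<open>
  If \<open>w = \<bar>W\<bar> \<ge> 2\<close> and \<open>V\<^sup>d \<noteq> W\<^sup>d\<close>, then \<open>w\<^sup>d - (w - 1)\<^sup>d \<le> \<bar>W - X\<bar>\<close> makes \<open>\<bar>X\<bar>\<close> at least \<open>w\<^sup>d\<^sup>-\<^sup>1\<close>,
  and then \<open>X\<^sup>2\<close> exceeds \<open>w\<^sup>d + \<bar>X\<bar> \<ge> \<bar>c\<bar>\<close>; so \<open>V\<^sup>d = W\<^sup>d\<close> and \<open>W\<close> is a fixed point.
  If \<open>w \<le> 1\<close>, then \<open>X\<^sup>2 \<le> \<bar>c\<bar>\<close> leaves finitely many values of \<open>c\<close> and \<open>X\<close>. Each of them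
  puts \<open>X\<close> on a cycle, or would make \<open>V\<^sup>d\<close> one of \<open>\<plusminus>2\<close>, \<open>\<plusminus>3\<close>, or gives \<open>\<bar>X\<^sup>d + c\<bar> = 2\<close>; the latter
  is excluded by hypothesis, as it is in the application, where \<open>X\<^sup>d + c\<close> is \<open>\<plusminus>\<close> a perfect power.
\<close>

lemma two_cycle_degree_ge_3:
  fixes V W X c :: int
  assumes d: "d \<ge> 3" and c: "c \<noteq> 0"
    and W: "W = V ^ d + c" and X: "X = W ^ d + c"
    and Xc: "X\<^sup>2 \<le> \<bar>c\<bar>" and not2: "\<bar>X ^ d + c\<bar> \<noteq> 2"
  shows "X ^ d + c = W"
proof -
  define w x where "w = \<bar>W\<bar>" and "x = \<bar>X\<bar>"
  have x2: "x\<^sup>2 = X\<^sup>2" by (simp add: x_def)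
  have Vd: "\<bar>V ^ d\<bar> \<le> 1 \<or> 4 \<le> \<bar>V ^ d\<bar>" using d by (intro abs_power_le_1_or_ge_4) auto
  have small_square: "t \<in> {-1, 0, 1}" if "t\<^sup>2 \<le> \<bar>t\<bar> + 1" for t :: int
  proof -
    have "\<bar>t\<bar> < 2"
    proof (rule ccontr)
      assume "\<not> \<bar>t\<bar> < 2"
      then have "2 * \<bar>t\<bar> \<le> \<bar>t\<bar> * \<bar>t\<bar>" by (intro mult_right_mono) auto
      then show False using that \<open>\<not> \<bar>t\<bar> < 2\<close> by (simp add: power2_eq_square)
    qed
    then show ?thesis by auto
  qed
  have sign: "(-1::int) ^ d = 1 \<or> (-1::int) ^ d = -1"
    by (cases "even d") auto
  consider "w = 0" | "w = 1" | "w \<ge> 2" unfolding w_def by linarith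
  then show ?thesis
  proof cases
    case 1
    then have W0: "W = 0" by (simp add: w_def)
    then have Xeq: "X = c" using X d by simp
    then have "c \<in> {-1, 0, 1}" using Xc by (intro small_square) simp
    then show ?thesis using c not2 W0 Xeq sign by auto
  next
    case 2
    then have W1: "W = 1 \<or> W = -1" by (auto simp: w_def)
    define t where "t = W ^ d"
    have t: "t = 1 \<or> t = -1 \<and> W = -1" using W1 sign by (auto simp: t_def)
    have Xt: "X = t + c" by (simp add: X t_def)
    have "X \<in> {-1, 0, 1}" using Xc t Xt by (intro small_square) auto
    then consider "X = -1" | "X = 0" | "X = 1" by blast
    then show ?thesis
    proof cases
      case 1
      \<comment> \<open>Only \<open>c = -2\<close> with the fixed point \<open>W = -1\<close> is possible.\<close>
      then have "W = X" using t Xt c W W1 Vd by linarith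
      then show ?thesis using X by simp
    next
      case 2
      \<comment> \<open>Only \<open>c = -1\<close> with the cycle between \<open>0\<close> and \<open>-1\<close> is possible.\<close>
      then have "c = -1" "W = -1" using t Xt W W1 Vd by linarith+
      then show ?thesis using 2 d by simp
    next
      case 3
      then show ?thesis using t Xt c W W1 Vd by linarith
    qed
  next
    case 3
    have "W = X"
    proof (rule ccontr)
      assume WX: "W \<noteq> X"
      have VW: "V ^ d - W ^ d = W - X" using W X by simp
      have "w ^ (d - 1) + w \<le> w ^ d - (w - 1) ^ d"
        using 3 d by (rule power_diff_pred_ge_add)
      also have "\<dots> \<le> \<bar>V ^ d - W ^ d\<bar>"
        unfolding w_def using WX VW 3 w_def by (intro power_gap) auto
      also have "\<dots> \<le> w + x" using VW by (simp add: w_def x_def)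
      finally have low: "w ^ (d - 1) \<le> x" by simp
      have wd: "w ^ d = w * w ^ (d - 1)" using d by (simp add: power_eq_if)
      have "w ^ 2 \<le> w ^ (d - 1)" using 3 d by (intro power_increasing) auto
      moreover have "2 * w \<le> w ^ 2" using 3 by (simp add: power2_eq_square)
      ultimately have wx: "w + 2 \<le> w ^ (d - 1)" using 3 by linarith
      have "\<bar>W ^ d\<bar> = w ^ d" by (simp add: w_def power_abs)
      then have "x\<^sup>2 \<le> w ^ d + x" using Xc x2 X x_def by linarith
      moreover have "w * w ^ (d - 1) \<le> w * x" using low 3 by (intro mult_left_mono) auto
      moreover have "(w + 2) * x \<le> x * x" using wx low 3 by (intro mult_right_mono) auto
      ultimately have "x \<le> 0" using wd by (simp add: power2_eq_square algebra_simps)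
      then show False using wx low 3 by linarith
    qed
    then show ?thesis using X by simp
  qed
qed

section \<open>The orbit ends in a short cycle\<close>

theorem theorem1p3:
  fixes d n p :: nat and c \<alpha> y \<epsilon> :: int and f :: "int \<Rightarrow> int"
  assumes "d \<ge> 2"
    and "c \<noteq> 0"
    and "f = (\<lambda>x. x ^ d + c)"
    and "\<epsilon> \<in> {1, -1}"
    and "prime p"
    and "p dvd d"
    and "d = 2 \<Longrightarrow> n \<ge> 4"
    and "d \<ge> 3 \<Longrightarrow> n \<ge> 3"
    and "(f ^^ n) \<alpha> = \<epsilon> * y ^ p"
  shows "preperiodic_point f \<alpha> \<and> periodic_point f (\<epsilon> * y ^ p)"
proof -
  note f = assms(3)
  have f_app: "f t = t ^ d + c" for t by (simp add: f)
  have n3: "n \<ge> 3" using assms(1,7,8) by (cases "d = 2") auto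
  then obtain m where n: "n = Suc (Suc (Suc m))"
    by (metis Suc_le_D Suc_le_mono numeral_3_eq_3)
  define V W X where "V = (f ^^ m) \<alpha>" and "W = f V" and "X = f W"
  have fX: "f X = \<epsilon> * y ^ p" using assms(9) by (simp add: n V_def W_def X_def)
  have "f X = W"
  proof (cases "d = 2")
    case True
    then have "p = 2" using assms(5,6) by (metis primes_dvd_imp_eq two_is_prime_nat)
    define k where "k = - c"
    have k: "k \<noteq> 0" "W = V\<^sup>2 - k" "X = W\<^sup>2 - k" "\<epsilon> * y\<^sup>2 = X\<^sup>2 - k"
      using fX assms(2) \<open>p = 2\<close> True by (simp_all add: k_def W_def X_def f_app)
    have "X\<^sup>2 - k = W"
    proof (cases "\<epsilon> = 1")
      case \<epsilon>: True
      obtain l where "m = Suc l" using assms(7)[OF True] n by (cases m) auto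
      then have "V = ((f ^^ l) \<alpha>)\<^sup>2 - k" by (simp add: V_def f_app True k_def)
      then show ?thesis using two_cycle_quadratic_diff[OF k(1) _ k(2,3)] k(4) \<epsilon> by simp
    next
      case False
      then have "- (y\<^sup>2) = X\<^sup>2 - k" using k(4) assms(4) by auto
      then show ?thesis using two_cycle_quadratic_sum[OF k(1-3)] by simp
    qed
    then show ?thesis by (simp add: f_app True k_def)
  next
    case False
    then have d: "d \<ge> 3" using assms(1) by simp
    have eq: "X ^ d + c = \<epsilon> * y ^ p" using fX by (simp add: f_app)
    have "\<bar>X ^ d + c\<bar> \<noteq> 2"
      using abs_power_le_1_or_ge_4[OF prime_ge_2_nat[OF assms(5)], of y] assms(4) eq by auto
    then have "X ^ d + c = W"
      using two_cycle_degree_ge_3[OF d assms(2)]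
        square_le_abs_const[OF d assms(5,6,2,4) eq] W_def X_def f_app by simp
    then show ?thesis by (simp add: f_app)
  qed
  then have "(f ^^ 2) (f X) = f X" by (simp add: numeral_2_eq_2 X_def)
  then have "periodic_point f (f X)"
    unfolding periodic_point_def by (intro exI[of _ 2]) simp
  then show ?thesis
    using fX assms(9) unfolding preperiodic_point_def by metis
qed

end
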